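(* Let $a,b\in(0,q^{-1})$, $0<|q|<1$, $|t|<\min\{(1-q)(1-aq)/a,1\}$. Then $$\frac{(t;q)_\infty}{(xt;q)_\infty}\;{}_0\phi_1\!\left(-;aq;q,aqxt\right)=\sum_{n=0}^\infty\frac{q^{\binom n2}(-t)^n(bq;q)_n}{(q;q)_n(aq;q)_n}\,p_n(x;b|q)\;{}_1\phi_1\!\left(a/b;aq^{n+1};q,bq^{n+1}t\right).$$
   Context: Notation: $(a;q)_0=1$, $(a;q)_n=\prod_{j=0}^{n-1}(1-aq^j)$, $(a;q)_\infty=\prod_{j\ge0}(1-aq^j)$, $(a_1,\dots,a_r;q)_n=\prod_i(a_i;q)_n$. The basic hypergeometric series, with upper parameters listed before the first semicolon and lower parameters before the second (a dash denotes an empty list), is $${}_r\phi_s(a_1,\dots,a_r;b_1,\dots,b_s;q,z)=\sum_{k=0}^\infty\frac{(a_1,\dots,a_r;q)_k}{(q,b_1,\dots,b_s;q)_k}\left((-1)^kq^{\binom k2}\right)^{1+s-r}z^k.$$ The little $q$-Laguerre/Wall polynomials in the variable $x$ are $$p_n(x;a|q)={}_2\phi_1\!\left(q^{-n},0;aq;q,qx\right).$$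
   Formalization: The condition |xt| < 1 is added: the statement gives no range for x, and for |xt| ≥ 1 the terms of the series on the right behave like a nonzero constant times (xt)^n, so it diverges; no case in which the series converges is excluded. *)

theory Defs
  imports "HOL-Analysis.Analysis"
begin

definition qpoch :: "complex \<Rightarrow> complex \<Rightarrow> nat \<Rightarrow> complex"
  where "qpoch a q n = (\<Prod>j<n. 1 - a * q ^ j)"

definition qpoch_inf :: "complex \<Rightarrow> complex \<Rightarrow> complex"
  where "qpoch_inf a q = (\<Prod>j. 1 - a * q ^ j)"

definition qpoch_list :: "complex list \<Rightarrow> complex \<Rightarrow> nat \<Rightarrow> complex"
  where "qpoch_list as q n = (\<Prod>a\<leftarrow>as. qpoch a q n)"

text \<open>
  The exponent \<open>1 + s - r\<close> is taken in the integers because it may be negative.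
\<close>

definition qhyp_term ::
    "complex list \<Rightarrow> complex list \<Rightarrow> complex \<Rightarrow> complex \<Rightarrow> nat \<Rightarrow> complex"
  where "qhyp_term as bs q z k =
    qpoch_list as q k / qpoch_list (q # bs) q k
      * ((-1) ^ k * q ^ (k choose 2)) powi (1 + int (length bs) - int (length as)) * z ^ k"

definition qhyp :: "complex list \<Rightarrow> complex list \<Rightarrow> complex \<Rightarrow> complex \<Rightarrow> complex"
  where "qhyp as bs q z = (\<Sum>k. qhyp_term as bs q z k)"

definition little_q_laguerre :: "nat \<Rightarrow> complex \<Rightarrow> complex \<Rightarrow> complex \<Rightarrow> complex"
  where "little_q_laguerre n x a q = qhyp [q powi (- int n), 0] [a * q] q (q * x)"

end

theory Submission
  imports Defs
begin

text \<open>
  Both sides are power series in \<open>x\<close>, and the identity is a comparison of the coefficients of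
  \<open>x ^ k\<close>. Multiplying the Wall polynomial by \<open>q ^ (n choose 2) / (q; q)_n\<close> turns the factor
  \<open>(q powi (- n); q)_k\<close> into \<open>1 / (q; q)_(n - k)\<close> (\<open>little_q_laguerre_expansion\<close>).
  Expanding also the \<open>1\<phi>1\<close> series with summation index \<open>j\<close>, and writing \<open>n = k + m\<close>, makes
  the right-hand side a sum over triples \<open>(k, m, j)\<close>.
  
  For fixed \<open>k\<close>, collect the triples with the same \<open>m + j = N\<close>. The powers of \<open>q\<close> combine
  to \<open>q ^ (N choose 2)\<close>, since \<open>(m choose 2) + (j choose 2) + m * j = (N choose 2)\<close>, and what
  remains is a \<open>q\<close>-Vandermonde sum. With \<open>r = a / b\<close> its value is
  \<open>(a q ^ (k + 1); q)_N / (q; q)_N\<close>, which cancels the part of \<open>(a q; q)_(k + N)\<close> that depends on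
  \<open>N\<close> (\<open>sum_triple_term\<close>). So \<open>b\<close> disappears, and the sum over \<open>N\<close> is Euler's series for
  \<open>(t; q)_\<infinity>\<close>.
  
  The remaining sum over \<open>k\<close> of \<open>(x t) ^ k / ((q; q)_k (a q; q)_k)\<close> equals the \<open>0\<phi>1\<close> series
  divided by \<open>(x t; q)_\<infinity>\<close>: multiplying it by Euler's series for \<open>(x t; q)_\<infinity>\<close> gives
  coefficients that a \<open>q\<close>-Pascal induction evaluates (\<open>qhyp_0_1_sums\<close>).
  
  The rearrangement is legitimate because the triple series converges absolutely: all
  \<open>q\<close>-Pochhammer factors and their inverses are bounded, as they converge to infinite products that
  are nonzero where an inverse is taken. What is left is a geometric series in \<open>x t\<close> times two
  series dominated by \<open>q ^ (n choose 2)\<close>.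
  
  All of this holds for complex \<open>q\<close>, \<open>b\<close> and \<open>r\<close> with \<open>0 < norm q < 1\<close> and
  \<open>norm (x * t) < 1\<close> as long as no lower parameter makes a denominator vanish; that version is \<open>little_q_laguerre_generating_function\<close>.
\<close>

(* The name also belongs to an older notion of summability; here it means summability of the
   norms, in the sense of has_sum. *)
no_notation Infinite_Set_Sum.abs_summable_on (infix \<open>abs'_summable'_on\<close> 50)

section \<open>Finite q-Pochhammer symbols\<close>

lemma qpoch_0 [simp]: "qpoch a q 0 = 1"
  by (simp add: qpoch_def)

lemma qpoch_Suc: "qpoch a q (Suc n) = qpoch a q n * (1 - a * q ^ n)"
  by (simp add: qpoch_def)

lemma qpoch_zero_left [simp]: "qpoch 0 q n = 1"
  by (simp add: qpoch_def)

lemma qpoch_add: "qpoch a q (m + n) = qpoch a q m * qpoch (a * q ^ m) q n"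
  by (induction n) (simp_all add: qpoch_Suc power_add mult_ac)

lemma qpoch_Suc_left: "qpoch a q (Suc n) = (1 - a) * qpoch (a * q) q n"
  using qpoch_add[of a q 1 n] by (simp add: qpoch_Suc)

lemma qpoch_nonzero: "(\<And>j. a * q ^ j \<noteq> 1) \<Longrightarrow> qpoch a q n \<noteq> 0"
  by (simp add: qpoch_def)

lemma mult_power_neq_1:
  fixes a q :: complex
  assumes "norm a < 1" "norm q < 1"
  shows "a * q ^ j \<noteq> 1"
proof -
  have "norm (a * q ^ j) \<le> norm a * 1"
    unfolding norm_mult norm_power using assms(2)
    by (intro mult_left_mono power_le_one) auto
  with assms(1) show ?thesis by auto
qed

lemma choose_two_Suc: "Suc n choose 2 = (n choose 2) + n"
  by (simp add: numeral_2_eq_2)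

lemma choose_two_add: "(m + n) choose 2 = (m choose 2) + (n choose 2) + m * n"
  by (induction n) (simp_all add: choose_two_Suc)

section \<open>Absolutely summable families\<close>

lemma bounded_range_mult:
  fixes f g :: "'a \<Rightarrow> complex"
  assumes "bounded (range f)" "bounded (range g)"
  shows "bounded (range (\<lambda>x. f x * g x))"
proof -
  obtain C D where "\<And>x. norm (f x) \<le> C" "\<And>x. norm (g x) \<le> D"
    using assms unfolding bounded_iff by blast
  then have "norm (f x * g x) \<le> C * D" for x
    unfolding norm_mult by (meson mult_mono norm_ge_zero order_trans)
  then show ?thesis unfolding bounded_iff by blast
qed

lemma bounded_range_comp: "bounded (range f) \<Longrightarrow> bounded (range (\<lambda>x. f (h x)))"
  by (erule bounded_subset) auto

text \<open>
  This reduces the convergence of every hypergeometric series below to that of a theta-like or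
  geometric series, because quotients of \<open>q\<close>-Pochhammer symbols are bounded.
\<close>

lemma abs_summable_on_mult_bounded:
  fixes f g :: "'a \<Rightarrow> complex"
  assumes "f abs_summable_on A" "bounded (range g)"
  shows "(\<lambda>x. f x * g x) abs_summable_on A"
proof -
  obtain C where C: "\<And>x. norm (g x) \<le> C"
    using assms(2) unfolding bounded_iff by blast
  have "(\<lambda>x. norm (f x) * C) summable_on A"
    by (rule summable_on_cmult_left) (rule assms(1))
  then show ?thesis
    by (rule summable_on_comparison_test) (auto simp: norm_mult C intro!: mult_left_mono)
qed

lemma abs_summable_on_Times:
  fixes f :: "'a \<Rightarrow> complex" and g :: "'b \<Rightarrow> complex"
  assumes "f abs_summable_on A" "g abs_summable_on B"
  shows "(\<lambda>(x, y). f x * g y) abs_summable_on A \<times> B"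
proof (rule Infinite_Sum.abs_summable_on_Sigma_iff[THEN iffD2], intro conjI ballI)
  fix x
  show "(\<lambda>y. case (x, y) of (x, y) \<Rightarrow> f x * g y) abs_summable_on B"
    using assms(2) by (simp add: norm_mult summable_on_cmult_right)
next
  show "(\<lambda>x. \<Sum>\<^sub>\<infinity>y\<in>B. norm (case (x, y) of (x, y) \<Rightarrow> f x * g y)) abs_summable_on A"
    using assms(1)
    by (simp add: norm_mult infsum_cmult_right' abs_mult summable_on_cmult_left)
qed

text \<open>
  Used once to pass from \<open>(k, m)\<close> to \<open>n = k + m\<close>, the index of the Wall polynomial, and once
  to pass from \<open>(m, j)\<close> to \<open>N = m + j\<close>.
\<close>

lemma has_sum_antidiagonals:
  fixes f :: "nat \<times> nat \<Rightarrow> complex"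
  assumes "(f has_sum S) UNIV"
  shows "((\<lambda>n. \<Sum>k\<le>n. f (k, n - k)) has_sum S) UNIV"
proof -
  have "((\<lambda>(n, k). f (k, n - k)) has_sum S) (Sigma UNIV (\<lambda>n. {..n}))
          \<longleftrightarrow> (f has_sum S) UNIV"
    by (rule has_sum_reindex_bij_witness[of _ "\<lambda>(k, m). (k + m, k)" "\<lambda>(n, k). (k, n - k)"])
       auto
  with assms have "((\<lambda>(n, k). f (k, n - k)) has_sum S) (Sigma UNIV (\<lambda>n. {..n}))"
    by simp
  then show ?thesis
    by (rule has_sum_SigmaD) auto
qed

section \<open>Finite identities from the q-Pascal rule\<close>

context
  fixes q :: complex
  assumes norm_q: "norm q < 1"
begin


lemma power_q_neq_1: "q * q ^ n \<noteq> 1"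
  by (rule mult_power_neq_1) (use norm_q in auto)

lemma one_minus_power_nonzero: "1 - q ^ Suc n \<noteq> 0"
  using power_q_neq_1[of n] by simp

lemma qpoch_q_nonzero: "qpoch q q n \<noteq> 0"
  by (rule qpoch_nonzero) (rule power_q_neq_1)

text \<open>
  With \<open>1 - q ^ Suc n = (1 - q ^ k) + q ^ k * (1 - q ^ (Suc n - k))\<close>, the first part lowers
  \<open>(q; q)_k\<close> and the second lowers \<open>(q; q)_(Suc n - k)\<close>. This is the \<open>q\<close>-Pascal rule for the
  coefficients \<open>1 / ((q; q)_k (q; q)_(n - k))\<close>, stated for an arbitrary weight so that convolution
  identities can be proved by induction on \<open>n\<close>.
\<close>

lemma q_Pascal_sum:
  "(\<Sum>k\<le>Suc n. f k (Suc n - k) / (qpoch q q k * qpoch q q (Suc n - k))) * (1 - q ^ Suc n)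
    = (\<Sum>k\<le>n. (f (Suc k) (n - k) + q ^ k * f k (Suc (n - k)))
                / (qpoch q q k * qpoch q q (n - k)))"
proof -
  let ?P = "qpoch q q"
  have "(\<Sum>k\<le>Suc n. f k (Suc n - k) / (?P k * ?P (Suc n - k))) * (1 - q ^ Suc n)
      = (\<Sum>k\<le>Suc n. (1 - q ^ k) * f k (Suc n - k) / (?P k * ?P (Suc n - k)))
      + (\<Sum>k\<le>Suc n. (q ^ k * (1 - q ^ (Suc n - k))) * f k (Suc n - k) / (?P k * ?P (Suc n - k)))"
    unfolding sum_distrib_right sum.distrib[symmetric]
  proof (rule sum.cong)
    fix k assume "k \<in> {..Suc n}"
    then have "q ^ Suc n = q ^ k * q ^ (Suc n - k)"
      by (simp flip: power_add del: power_Suc)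
    then show "f k (Suc n - k) / (?P k * ?P (Suc n - k)) * (1 - q ^ Suc n)
      = (1 - q ^ k) * f k (Suc n - k) / (?P k * ?P (Suc n - k))
      + (q ^ k * (1 - q ^ (Suc n - k))) * f k (Suc n - k) / (?P k * ?P (Suc n - k))"
      by (simp add: algebra_simps flip: add_divide_distrib diff_divide_distrib del: power_Suc)
  qed simp
  also have "(\<Sum>k\<le>Suc n. (1 - q ^ k) * f k (Suc n - k) / (?P k * ?P (Suc n - k)))
      = (\<Sum>k\<le>n. f (Suc k) (n - k) / (?P k * ?P (n - k)))"
  proof -
    have "(1 - q ^ Suc k) * f (Suc k) (n - k) / (?P (Suc k) * ?P (n - k))
            = f (Suc k) (n - k) / (?P k * ?P (n - k))" for k
      using power_q_neq_1[of k] by (simp add: qpoch_Suc)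
    then show ?thesis by (subst sum.atMost_Suc_shift) simp
  qed
  also have "(\<Sum>k\<le>Suc n. (q ^ k * (1 - q ^ (Suc n - k))) * f k (Suc n - k)
                 / (?P k * ?P (Suc n - k)))
      = (\<Sum>k\<le>n. q ^ k * f k (Suc (n - k)) / (?P k * ?P (n - k)))"
  proof -
    have "(q ^ k * (1 - q ^ (Suc n - k))) * f k (Suc n - k) / (?P k * ?P (Suc n - k))
            = q ^ k * f k (Suc (n - k)) / (?P k * ?P (n - k))" if "k \<le> n" for k
      using that power_q_neq_1[of "n - k"] by (simp add: qpoch_Suc Suc_diff_le)
    then show ?thesis by simp
  qed
  finally show ?thesis
    by (simp add: sum.distrib[symmetric] add_divide_distrib)
qed

text \<open>
  The coefficient of \<open>z ^ n\<close> in \<open>(b z)_\<infinity> / (z)_\<infinity> * (r b z)_\<infinity> / (b z)_\<infinity> = (r b z)_\<infinity> / (z)_\<infinity>\<close>,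
  each quotient expanded by the \<open>q\<close>-binomial theorem. In the induction, the two weights produced by
  the \<open>q\<close>-Pascal rule add up to the old weight times \<open>1 - r * b * q ^ n\<close>, a factor that does not
  depend on \<open>m\<close>.
\<close>

lemma q_Vandermonde:
  "(\<Sum>m\<le>n. qpoch b q m * (qpoch r q (n - m) * b ^ (n - m)) / (qpoch q q m * qpoch q q (n - m)))
     = qpoch (r * b) q n / qpoch q q n"
proof (induction n)
  case (Suc n)
  let ?P = "qpoch q q"
  have "(\<Sum>m\<le>Suc n. qpoch b q m * (qpoch r q (Suc n - m) * b ^ (Suc n - m))
            / (?P m * ?P (Suc n - m))) * (1 - q ^ Suc n)
      = (\<Sum>m\<le>n. (1 - r * b * q ^ n) * (qpoch b q m * (qpoch r q (n - m) * b ^ (n - m))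
            / (?P m * ?P (n - m))))"
    unfolding q_Pascal_sum[of "\<lambda>m j. qpoch b q m * (qpoch r q j * b ^ j)"]
  proof (rule sum.cong)
    fix m assume "m \<in> {..n}"
    then have "q ^ n = q ^ m * q ^ (n - m)" by (simp flip: power_add)
    then have "qpoch b q (Suc m) * (qpoch r q (n - m) * b ^ (n - m))
          + q ^ m * (qpoch b q m * (qpoch r q (Suc (n - m)) * b ^ Suc (n - m)))
        = (1 - r * b * q ^ n) * (qpoch b q m * (qpoch r q (n - m) * b ^ (n - m)))"
      by (simp add: qpoch_Suc algebra_simps)
    then show "(qpoch b q (Suc m) * (qpoch r q (n - m) * b ^ (n - m))
          + q ^ m * (qpoch b q m * (qpoch r q (Suc (n - m)) * b ^ Suc (n - m))))
          / (?P m * ?P (n - m))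
        = (1 - r * b * q ^ n) * (qpoch b q m * (qpoch r q (n - m) * b ^ (n - m))
            / (?P m * ?P (n - m)))"
      by simp
  qed simp
  also have "\<dots> = (1 - r * b * q ^ n) * (qpoch (r * b) q n / ?P n)"
    unfolding sum_distrib_left[symmetric] Suc.IH ..
  finally show ?case
    by (rule trans[OF eq_divide_imp[OF one_minus_power_nonzero]]) (simp add: qpoch_Suc)
qed simp

text \<open>
  A limiting case of the \<open>q\<close>-Chu-Vandermonde sum. Calling the left-hand side \<open>h n c\<close>, the
  \<open>q\<close>-Pascal rule gives
  \<open>h (Suc n) c * (1 - q ^ Suc n) = h n (c * q) / (1 - c) - q ^ n * h n c\<close>; the shift of \<open>c\<close> is
  why the induction is for all \<open>c\<close> at once.
\<close>

lemma q_binomial_inversion: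
  assumes "\<And>j. c * q ^ j \<noteq> 1"
  shows "(\<Sum>k\<le>n. (-1) ^ (n - k) * q ^ ((n - k) choose 2) / qpoch c q k
              / (qpoch q q k * qpoch q q (n - k)))
     = (q ^ (n choose 2))\<^sup>2 * c ^ n / (qpoch q q n * qpoch c q n)"
  using assms
proof (induction n arbitrary: c)
  case (Suc n)
  let ?P = "qpoch q q"
  let ?h = "\<lambda>c. \<Sum>k\<le>n. (-1) ^ (n - k) * q ^ ((n - k) choose 2) / qpoch c q k
              / (?P k * ?P (n - k))"
  have c1: "1 - c \<noteq> 0" using Suc.prems[of 0] by auto
  have shift: "c * q * q ^ j \<noteq> 1" for j
    using Suc.prems[of "Suc j"] by (simp add: mult_ac)
  have "(\<Sum>k\<le>Suc n. (-1) ^ (Suc n - k) * q ^ ((Suc n - k) choose 2) / qpoch c q k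
              / (?P k * ?P (Suc n - k))) * (1 - q ^ Suc n)
      = (\<Sum>k\<le>n. (-1) ^ (n - k) * q ^ ((n - k) choose 2) / qpoch (c * q) q k
              / (?P k * ?P (n - k)) / (1 - c)
           - q ^ n * ((-1) ^ (n - k) * q ^ ((n - k) choose 2) / qpoch c q k
              / (?P k * ?P (n - k))))"
    unfolding q_Pascal_sum[of "\<lambda>k m. (-1) ^ m * q ^ (m choose 2) / qpoch c q k"]
  proof (rule sum.cong)
    fix k assume "k \<in> {..n}"
    then have "q ^ n = q ^ k * q ^ (n - k)" by (simp flip: power_add)
    then show "((-1) ^ (n - k) * q ^ ((n - k) choose 2) / qpoch c q (Suc k)
         + q ^ k * ((-1) ^ Suc (n - k) * q ^ (Suc (n - k) choose 2) / qpoch c q k))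
          / (?P k * ?P (n - k))
      = (-1) ^ (n - k) * q ^ ((n - k) choose 2) / qpoch (c * q) q k
              / (?P k * ?P (n - k)) / (1 - c)
           - q ^ n * ((-1) ^ (n - k) * q ^ ((n - k) choose 2) / qpoch c q k
              / (?P k * ?P (n - k)))"
      by (simp add: qpoch_Suc_left choose_two_Suc power_add diff_divide_distrib mult_ac)
  qed simp
  also have "\<dots> = ?h (c * q) / (1 - c) - q ^ n * ?h c"
    by (simp add: sum_subtractf sum_divide_distrib sum_distrib_left)
  also have "\<dots> = (q ^ (n choose 2))\<^sup>2 * (c * q) ^ n / (?P n * qpoch c q (Suc n))
                - q ^ n * ((q ^ (n choose 2))\<^sup>2 * c ^ n / (?P n * qpoch c q n))"
    using Suc.IH[of "c * q"] Suc.IH[of c] shift Suc.prems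
    by (simp add: qpoch_Suc_left mult_ac)
  also have "\<dots> = (q ^ (Suc n choose 2))\<^sup>2 * c ^ Suc n / (?P n * qpoch c q (Suc n))"
    using Suc.prems[of n] qpoch_nonzero[of c q n] Suc.prems qpoch_q_nonzero[of n]
    by (simp add: qpoch_Suc choose_two_Suc power_add power_mult_distrib divide_simps)
       (simp add: algebra_simps power2_eq_square)
  finally show ?case
    by (rule trans[OF eq_divide_imp[OF one_minus_power_nonzero]]) (simp add: qpoch_Suc)
qed (simp add: binomial_eq_0)

section \<open>Infinite products and Euler's series\<close>

lemma qpoch_tendsto: "qpoch a q \<longlonglongrightarrow> qpoch_inf a q"
  and qpoch_inf_nonzero: "(\<And>j. a * q ^ j \<noteq> 1) \<Longrightarrow> qpoch_inf a q \<noteq> 0"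
proof -
  have "summable (\<lambda>j. norm (1 - a * q ^ j - 1))"
    using norm_q by (simp add: norm_mult norm_power summable_mult summable_geometric)
  then have conv: "convergent_prod (\<lambda>j. 1 - a * q ^ j)"
    by (intro abs_convergent_prod_imp_convergent_prod summable_imp_abs_convergent_prod)
  from convergent_prod_LIMSEQ[OF this] show "qpoch a q \<longlonglongrightarrow> qpoch_inf a q"
    unfolding qpoch_inf_def qpoch_def by (simp add: LIMSEQ_lessThan_iff_atMost)
  show "qpoch_inf a q \<noteq> 0" if "\<And>j. a * q ^ j \<noteq> 1"
    unfolding qpoch_inf_def using that by (intro prodinf_nonzero[OF conv]) simp
qed

lemma bounded_qpoch: "bounded (range (qpoch a q))"
  using qpoch_tendsto by (rule convergent_imp_bounded)

lemma bounded_inverse_qpoch: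
  assumes "\<And>j. a * q ^ j \<noteq> 1"
  shows "bounded (range (\<lambda>n. inverse (qpoch a q n)))"
  using tendsto_inverse[OF qpoch_tendsto qpoch_inf_nonzero[OF assms]] convergent_imp_bounded
  by blast

lemma bounded_power_q: "bounded (range (\<lambda>n. q ^ n))"
  unfolding bounded_iff using norm_q by (auto simp: norm_power intro!: exI[of _ 1] power_le_one)

lemma abs_summable_theta: "(\<lambda>n. q ^ (n choose 2) * w ^ n) abs_summable_on UNIV"
proof -
  have "(\<lambda>n. norm (q ^ n * w)) \<longlonglongrightarrow> 0"
    using norm_q by (intro tendsto_norm_zero tendsto_mult_left_zero LIMSEQ_power_zero)
  then have "eventually (\<lambda>n. norm (q ^ n * w) < 1/2) sequentially"
    by (rule order_tendstoD) simp
  then obtain N where N: "\<And>n. n \<ge> N \<Longrightarrow> norm (q ^ n * w) < 1/2"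
    unfolding eventually_sequentially by blast
  have "summable (\<lambda>n. norm (q ^ (n choose 2) * w ^ n))"
  proof (rule summable_ratio_test[of "1/2" N])
    fix n assume "n \<ge> N"
    have "norm (q ^ (Suc n choose 2) * w ^ Suc n)
        = norm (q ^ n * w) * norm (q ^ (n choose 2) * w ^ n)"
      by (simp add: choose_two_Suc power_add norm_mult mult_ac)
    also have "\<dots> \<le> 1/2 * norm (q ^ (n choose 2) * w ^ n)"
      using N[OF \<open>n \<ge> N\<close>] by (intro mult_right_mono) auto
    finally show "norm (norm (q ^ (Suc n choose 2) * w ^ Suc n))
        \<le> 1/2 * norm (norm (q ^ (n choose 2) * w ^ n))" by simp
  qed simp
  then show ?thesis
    by (subst summable_on_UNIV_nonneg_real_iff) auto
qed

lemma abs_summable_Euler: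
  "(\<lambda>n. (-1) ^ n * q ^ (n choose 2) / qpoch q q n * t ^ n) abs_summable_on UNIV"
proof -
  have "(\<lambda>n. q ^ (n choose 2) * (-t) ^ n * inverse (qpoch q q n)) abs_summable_on UNIV"
    by (intro abs_summable_on_mult_bounded abs_summable_theta bounded_inverse_qpoch power_q_neq_1)
  then show ?thesis
    by (simp add: norm_mult norm_divide norm_inverse norm_power field_simps)
qed

lemma summable_norm_of_abs_summable_on:
  "f abs_summable_on UNIV \<Longrightarrow> summable (\<lambda>n. norm (f n))" for f :: "nat \<Rightarrow> complex"
  by (subst (asm) summable_on_UNIV_nonneg_real_iff) auto

text \<open>
  The series \<open>f\<close> satisfies \<open>f t = (1 - t) * f (t * q)\<close>, as does the product. Iterating gives
  \<open>f t = (t; q)_n * f (t * q ^ n)\<close>, and \<open>f\<close> is continuous at \<open>0\<close> with value \<open>1\<close>.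
\<close>

lemma Euler_qpoch_inf:
  "(\<lambda>n. (-1) ^ n * q ^ (n choose 2) / qpoch q q n * t ^ n) sums qpoch_inf t q"
proof -
  define e where "e = (\<lambda>n. (-1) ^ n * q ^ (n choose 2) / qpoch q q n)"
  define f where "f = (\<lambda>t. \<Sum>n. e n * t ^ n)"
  have summ: "summable (\<lambda>n. e n * t ^ n)" for t
    unfolding e_def
    by (rule summable_on_imp_summable[OF abs_summable_summable[OF abs_summable_Euler]])
  have e_Suc: "e (Suc n) * (1 - q ^ Suc n) = - (q ^ n * e n)" for n
    using power_q_neq_1[of n] qpoch_q_nonzero[of n]
    by (simp add: e_def qpoch_Suc choose_two_Suc power_add)
  have step: "f t = (1 - t) * f (t * q)" for t
  proof -
    have "f t - f (t * q) = (\<Sum>n. e n * t ^ n - e n * (t * q) ^ n)"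
      unfolding f_def by (rule suminf_diff[OF summ summ])
    also have "\<dots> = (\<Sum>n. e (Suc n) * t ^ Suc n - e (Suc n) * (t * q) ^ Suc n)"
      using suminf_split_head[OF summable_diff[OF summ[of t] summ[of "t * q"]]] by simp
    also have "\<dots> = (\<Sum>n. - t * (e n * (t * q) ^ n))"
    proof (rule arg_cong[where f = suminf], rule ext)
      fix n
      have "e (Suc n) * t ^ Suc n - e (Suc n) * (t * q) ^ Suc n
          = e (Suc n) * (1 - q ^ Suc n) * t ^ Suc n"
        unfolding power_mult_distrib by (simp add: algebra_simps)
      then show "e (Suc n) * t ^ Suc n - e (Suc n) * (t * q) ^ Suc n = - t * (e n * (t * q) ^ n)"
        unfolding e_Suc by (simp add: power_mult_distrib)
    qed
    also have "\<dots> = - t * f (t * q)"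
      unfolding f_def by (rule suminf_mult[OF summ])
    finally show ?thesis by (simp add: algebra_simps)
  qed
  have iter: "f t = qpoch t q n * f (t * q ^ n)" for n
  proof (induction n)
    case (Suc n)
    then show ?case
      using step[of "t * q ^ n"] by (simp add: qpoch_Suc mult_ac)
  qed simp
  have "(\<lambda>n. t * q ^ n) \<longlonglongrightarrow> 0"
    using norm_q by (intro tendsto_mult_right_zero LIMSEQ_power_zero)
  moreover have "isCont f 0"
    unfolding f_def using summ by (rule isCont_powser_converges_everywhere)
  ultimately have "(\<lambda>n. f (t * q ^ n)) \<longlonglongrightarrow> f 0"
    using isCont_tendsto_compose by blast
  moreover have "f 0 = 1"
    unfolding f_def powser_zero by (simp add: e_def binomial_eq_0)
  ultimately have "(\<lambda>n. qpoch t q n * f (t * q ^ n)) \<longlonglongrightarrow> qpoch_inf t q * 1"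
    by (intro tendsto_mult qpoch_tendsto) simp
  also have "(\<lambda>n. qpoch t q n * f (t * q ^ n)) = (\<lambda>n. f t)"
    by (rule ext) (rule iter[symmetric])
  finally have "f t = qpoch_inf t q"
    using LIMSEQ_unique[OF tendsto_const] by fastforce
  with summ[of t] show ?thesis
    unfolding f_def e_def by (simp add: sums_iff)
qed

section \<open>The hypergeometric series involved\<close>

text \<open>
  The Cauchy product of the left-hand series with Euler's series for \<open>(z; q)_\<infinity>\<close> is, coefficient
  by coefficient, the \<open>0\<phi>1\<close> series.
\<close>

lemma qhyp_0_1_sums:
  assumes "\<And>j. c * q ^ j \<noteq> 1" and "norm z < 1"
  shows "(\<lambda>k. z ^ k / (qpoch q q k * qpoch c q k))
           sums (qhyp [] [c] q (c * z) / qpoch_inf z q)"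
proof -
  define a where "a = (\<lambda>k. z ^ k / (qpoch q q k * qpoch c q k))"
  define e where "e = (\<lambda>m. (-1) ^ m * q ^ (m choose 2) / qpoch q q m * z ^ m)"
  have "(\<lambda>k. z ^ k * (inverse (qpoch q q k) * inverse (qpoch c q k))) abs_summable_on UNIV"
    using assms(2)
    by (intro abs_summable_on_mult_bounded bounded_range_mult bounded_inverse_qpoch
          power_q_neq_1 assms(1))
       (auto simp: norm_power summable_on_UNIV_nonneg_real_iff)
  then have a_abs: "a abs_summable_on UNIV"
    by (simp add: a_def norm_mult norm_divide norm_inverse norm_power field_simps)
  have "(\<lambda>n. \<Sum>k\<le>n. a k * e (n - k)) sums (suminf a * suminf e)"
    unfolding e_def
    by (intro Cauchy_product_sums summable_norm_of_abs_summable_on a_abs abs_summable_Euler)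
  moreover have "suminf e = qpoch_inf z q"
    unfolding e_def using Euler_qpoch_inf by (simp add: sums_iff)
  moreover have "(\<Sum>k\<le>n. a k * e (n - k)) = qhyp_term [] [c] q (c * z) n" for n
  proof -
    have "(\<Sum>k\<le>n. a k * e (n - k))
        = (\<Sum>k\<le>n. z ^ n * ((-1) ^ (n - k) * q ^ ((n - k) choose 2) / qpoch c q k
              / (qpoch q q k * qpoch q q (n - k))))"
    proof (rule sum.cong)
      fix k assume "k \<in> {..n}"
      then have "z ^ n = z ^ k * z ^ (n - k)" by (simp flip: power_add)
      then show "a k * e (n - k) = z ^ n * ((-1) ^ (n - k) * q ^ ((n - k) choose 2) / qpoch c q k
              / (qpoch q q k * qpoch q q (n - k)))"
        by (simp add: a_def e_def mult_ac)
    qed simp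
    also have "\<dots> = z ^ n * ((q ^ (n choose 2))\<^sup>2 * c ^ n / (qpoch q q n * qpoch c q n))"
      unfolding sum_distrib_left[symmetric] q_binomial_inversion[OF assms(1)] ..
    also have "\<dots> = qhyp_term [] [c] q (c * z) n"
      by (simp add: qhyp_term_def qpoch_list_def power_mult_distrib flip: power_mult)
    finally show ?thesis .
  qed
  ultimately have "qhyp_term [] [c] q (c * z) sums (suminf a * qpoch_inf z q)"
    by simp
  then have "suminf a * qpoch_inf z q = qhyp [] [c] q (c * z)"
    by (simp add: qhyp_def sums_iff)
  moreover have "qpoch_inf z q \<noteq> 0"
    by (intro qpoch_inf_nonzero mult_power_neq_1 assms(2) norm_q)
  ultimately have "suminf a = qhyp [] [c] q (c * z) / qpoch_inf z q"
    by (simp add: field_simps)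
  moreover have "summable a"
    by (rule summable_on_imp_summable[OF abs_summable_summable[OF a_abs]])
  ultimately show ?thesis
    by (simp add: sums_iff a_def)
qed

lemma qhyp_1_1_has_sum:
  assumes "\<And>j. c * q ^ j \<noteq> 1"
  shows "(qhyp_term [r] [c] q z has_sum qhyp [r] [c] q z) UNIV"
proof -
  have "(\<lambda>j. q ^ (j choose 2) * (- z) ^ j
          * (qpoch r q j * inverse (qpoch q q j) * inverse (qpoch c q j))) abs_summable_on UNIV"
    by (intro abs_summable_on_mult_bounded abs_summable_theta bounded_range_mult
          bounded_qpoch bounded_inverse_qpoch power_q_neq_1 assms)
  also have "(\<lambda>j. q ^ (j choose 2) * (- z) ^ j
          * (qpoch r q j * inverse (qpoch q q j) * inverse (qpoch c q j)))
      = qhyp_term [r] [c] q z"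
    by (rule ext) (simp add: qhyp_term_def qpoch_list_def divide_inverse power_minus[of z] mult_ac)
  finally have abs: "qhyp_term [r] [c] q z abs_summable_on UNIV" .
  then have "summable (qhyp_term [r] [c] q z)"
    by (rule summable_on_imp_summable[OF abs_summable_summable])
  with abs show ?thesis
    unfolding qhyp_def
    by (rule norm_summable_imp_has_sum[OF summable_norm_of_abs_summable_on summable_sums])
qed

text \<open>
  The identity \<open>(q powi (- n); q)_k = (-1) ^ k * q ^ ((k choose 2) - n * k) * (q; q)_n / (q; q)_(n - k)\<close>,
  with the powers of \<open>q\<close> distributed so that all exponents are natural numbers.
\<close>

lemma qpoch_power_minus:
  assumes "q \<noteq> 0" "k \<le> n"
  shows "q ^ (n choose 2) * qpoch (q powi (- int n)) q k * q ^ k * qpoch q q (n - k)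
           = (-1) ^ k * q ^ ((n - k) choose 2) * qpoch q q n"
  using assms(2)
proof (induction k)
  case (Suc k)
  define r where "r = n - Suc k"
  have r: "n - k = Suc r" "n = Suc r + k" using Suc.prems by (simp_all add: r_def)
  have nonzero: "q ^ Suc r * (1 - q ^ Suc r) \<noteq> 0"
    using assms(1) one_minus_power_nonzero[of r] by simp
  let ?R = "qpoch (q powi (- int n)) q"
  have "q powi (- int n) * q ^ k = inverse (q ^ Suc r)"
    using assms(1) unfolding r(2) power_int_minus power_int_of_nat power_add by simp
  then have "?R (Suc k) * q ^ Suc r = ?R k * (1 - inverse (q ^ Suc r)) * q ^ Suc r"
    by (simp only: qpoch_Suc)
  also have "\<dots> = ?R k * (q ^ Suc r - inverse (q ^ Suc r) * q ^ Suc r)"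
    by (simp only: left_diff_distrib mult_1 mult.assoc)
  also have "inverse (q ^ Suc r) * q ^ Suc r = 1"
    by (rule left_inverse) (use assms(1) in simp)
  finally have R: "?R (Suc k) * q ^ Suc r = - ?R k * (1 - q ^ Suc r)"
    by (simp add: algebra_simps)
  have "q ^ (n choose 2) * ?R (Suc k) * q ^ Suc k * qpoch q q r * (q ^ Suc r * (1 - q ^ Suc r))
      = - (q ^ (n choose 2) * ?R k * q ^ k * qpoch q q (Suc r)) * q * (1 - q ^ Suc r)"
  proof -
    have "q ^ (n choose 2) * ?R (Suc k) * q ^ Suc k * qpoch q q r * (q ^ Suc r * (1 - q ^ Suc r))
        = q ^ (n choose 2) * (?R (Suc k) * q ^ Suc r) * q ^ Suc k * qpoch q q r * (1 - q ^ Suc r)"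
      by (simp only: mult_ac)
    then show ?thesis
      unfolding R by (simp add: qpoch_Suc[of q q r])
  qed
  also have "\<dots> = - ((-1) ^ k * q ^ (Suc r choose 2) * qpoch q q n) * q * (1 - q ^ Suc r)"
    using Suc.IH Suc.prems by (simp add: r(1))
  also have "\<dots> = (-1) ^ Suc k * q ^ (r choose 2) * qpoch q q n * (q ^ Suc r * (1 - q ^ Suc r))"
    by (simp add: choose_two_Suc power_add)
  finally show ?case
    unfolding r_def[symmetric] by (rule mult_right_cancel[OF nonzero, THEN iffD1])
qed simp

text \<open>
  In this normalisation the coefficient of \<open>x ^ k\<close> depends on \<open>n\<close> only through \<open>n - k\<close>, which is
  what makes the sum over \<open>n\<close> split into independent sums over \<open>k\<close> and \<open>m = n - k\<close>.
\<close>

lemma little_q_laguerre_expansion: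
  assumes "q \<noteq> 0"
  shows "q ^ (n choose 2) * little_q_laguerre n x b q / qpoch q q n
       = (\<Sum>k\<le>n. (- x) ^ k * q ^ ((n - k) choose 2)
            / (qpoch (b * q) q k * qpoch q q k * qpoch q q (n - k)))"
proof -
  let ?R = "qpoch (q powi (- int n)) q"
  (* The defining series terminates. *)
  have R0: "?R k = 0" if "k > n" for k
  proof -
    have "1 - q powi (- int n) * q ^ n = 0"
      using assms by (simp add: power_int_minus)
    with that show ?thesis unfolding qpoch_def by (intro prod_zero) auto
  qed
  have "little_q_laguerre n x b q
      = (\<Sum>k\<le>n. ?R k / (qpoch q q k * qpoch (b * q) q k) * (q * x) ^ k)"
    unfolding little_q_laguerre_def qhyp_def
    by (subst suminf_finite[of "{..n}"])
       (auto simp: qhyp_term_def qpoch_list_def R0 intro!: sum.cong)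
  then have "q ^ (n choose 2) * little_q_laguerre n x b q / qpoch q q n
      = (\<Sum>k\<le>n. q ^ (n choose 2) * (?R k / (qpoch q q k * qpoch (b * q) q k) * (q * x) ^ k)
            / qpoch q q n)"
    by (simp add: sum_distrib_left sum_divide_distrib)
  also have "\<dots> = (\<Sum>k\<le>n. (- x) ^ k * q ^ ((n - k) choose 2)
            / (qpoch (b * q) q k * qpoch q q k * qpoch q q (n - k)))"
  proof (rule sum.cong)
    fix k assume "k \<in> {..n}"
    then have "q ^ (n choose 2) * ?R k * q ^ k / qpoch q q n
        = (-1) ^ k * q ^ ((n - k) choose 2) / qpoch q q (n - k)"
      using qpoch_power_minus[OF assms, of k n] qpoch_q_nonzero
      by (simp add: frac_eq_eq)
    then have "q ^ (n choose 2) * ?R k * q ^ k / qpoch q q n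
          * (x ^ k / (qpoch q q k * qpoch (b * q) q k))
        = (-1) ^ k * q ^ ((n - k) choose 2) / qpoch q q (n - k)
          * (x ^ k / (qpoch q q k * qpoch (b * q) q k))"
      by simp
    then show "q ^ (n choose 2) * (?R k / (qpoch q q k * qpoch (b * q) q k) * (q * x) ^ k)
            / qpoch q q n
        = (- x) ^ k * q ^ ((n - k) choose 2)
            / (qpoch (b * q) q k * qpoch q q k * qpoch q q (n - k))"
      by (simp add: power_mult_distrib power_minus[of x] mult_ac)
  qed simp
  finally show ?thesis .
qed

section \<open>The triple series\<close>

text \<open>
  The right-hand side with \<open>n = k + m\<close> and both hypergeometric functions expanded. The
  argument \<open>b\<close> is the product \<open>b q\<close> of the final theorem, and \<open>r * b\<close> is \<open>a q\<close>; the two symbols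
  \<open>(a q; q)_n\<close> and \<open>(a q ^ (n + 1); q)_j\<close> are merged into \<open>(a q; q)_(n + j)\<close>.
\<close>

definition triple_term ::
    "complex \<Rightarrow> complex \<Rightarrow> complex \<Rightarrow> complex \<Rightarrow> nat \<times> nat \<times> nat \<Rightarrow> complex"
  where "triple_term b r t x = (\<lambda>(k, m, j).
    (x * t) ^ k / (qpoch b q k * qpoch q q k)
      * ((- t) ^ m * q ^ (m choose 2) / qpoch q q m)
      * (qpoch b q (k + m) / qpoch (r * b) q (k + m + j))
      * (qpoch r q j / qpoch q q j * q ^ (j choose 2) * (- (b * q ^ (k + m) * t)) ^ j))"

lemma abs_summable_triple_term:
  assumes "\<And>j. b * q ^ j \<noteq> 1" "\<And>j. r * b * q ^ j \<noteq> 1" "norm (x * t) < 1"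
  shows "triple_term b r t x abs_summable_on UNIV"
proof -
  let ?main = "\<lambda>(k, m, j). (x * t) ^ k
      * ((q ^ (m choose 2) * (- t) ^ m) * (q ^ (j choose 2) * (- (b * t)) ^ j))"
  let ?coeff = "\<lambda>(k, m, j). inverse (qpoch b q k) * inverse (qpoch q q k)
      * inverse (qpoch q q m) * qpoch b q (k + m) * inverse (qpoch (r * b) q (k + m + j))
      * qpoch r q j * inverse (qpoch q q j) * q ^ ((k + m) * j)"
  have "(\<lambda>k. (x * t) ^ k) abs_summable_on UNIV"
    using assms(3) by (auto simp: norm_power summable_on_UNIV_nonneg_real_iff)
  then have "(\<lambda>(k, p). (x * t) ^ k *
      (\<lambda>(m, j). (q ^ (m choose 2) * (- t) ^ m) * (q ^ (j choose 2) * (- (b * t)) ^ j)) p)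
      abs_summable_on UNIV \<times> UNIV \<times> UNIV"
    by (intro abs_summable_on_Times abs_summable_theta)
  then have main: "?main abs_summable_on UNIV"
    by (simp add: case_prod_unfold)
  have "bounded (range (\<lambda>p. inverse (qpoch b q (fst p)) * inverse (qpoch q q (fst p))
      * inverse (qpoch q q (fst (snd p))) * qpoch b q (fst p + fst (snd p))
      * inverse (qpoch (r * b) q (fst p + fst (snd p) + snd (snd p)))
      * qpoch r q (snd (snd p)) * inverse (qpoch q q (snd (snd p)))
      * q ^ ((fst p + fst (snd p)) * snd (snd p))))"
    by (intro bounded_range_mult bounded_range_comp[OF bounded_qpoch]
          bounded_range_comp[OF bounded_inverse_qpoch] bounded_range_comp[OF bounded_power_q]
          assms power_q_neq_1)
  then have coeff: "bounded (range ?coeff)"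
    by (simp add: case_prod_unfold)
  have "triple_term b r t x = (\<lambda>p. ?main p * ?coeff p)"
  proof (rule ext)
    fix p :: "nat \<times> nat \<times> nat"
    obtain k m j where p: "p = (k, m, j)" by (cases p)
    have "(- (b * q ^ (k + m) * t)) ^ j = (- (b * t)) ^ j * q ^ ((k + m) * j)"
      by (simp add: power_mult flip: power_mult_distrib)
         (simp add: mult_ac)
    then show "triple_term b r t x p = ?main p * ?coeff p"
      by (simp add: p triple_term_def divide_inverse mult_ac)
  qed
  then show ?thesis
    using abs_summable_on_mult_bounded[OF main coeff] by simp
qed

text \<open>
  The summation that eliminates \<open>b\<close>: it is the \<open>q\<close>-Vandermonde sum with parameter \<open>b * q ^ k\<close>,
  whose value \<open>(r * b * q ^ k; q)_n / (q; q)_n\<close> cancels against \<open>(r * b; q)_(k + n)\<close>.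
\<close>

lemma sum_triple_term:
  assumes "\<And>j. b * q ^ j \<noteq> 1" "\<And>j. r * b * q ^ j \<noteq> 1"
  shows "(\<Sum>m\<le>n. triple_term b r t x (k, m, n - m))
    = (x * t) ^ k / (qpoch q q k * qpoch (r * b) q k)
        * ((-1) ^ n * q ^ (n choose 2) / qpoch q q n * t ^ n)"
proof -
  let ?B = "b * q ^ k"
  let ?C = "(x * t) ^ k / (qpoch q q k * qpoch (r * b) q (k + n)) * ((- t) ^ n * q ^ (n choose 2))"
  have "(\<Sum>m\<le>n. triple_term b r t x (k, m, n - m))
      = (\<Sum>m\<le>n. ?C * (qpoch ?B q m * (qpoch r q (n - m) * ?B ^ (n - m))
            / (qpoch q q m * qpoch q q (n - m))))"
  proof (rule sum.cong)
    fix m assume "m \<in> {..n}"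
    then obtain j where n: "n = m + j" by (auto simp: le_iff_add)
    have "qpoch b q (k + m) = qpoch b q k * qpoch ?B q m" by (rule qpoch_add)
    moreover have "(- (b * q ^ (k + m) * t)) ^ j = ?B ^ j * (q ^ (m * j) * (- t) ^ j)"
      by (simp add: power_mult power_add flip: power_mult_distrib)
         (simp add: mult_ac)
    ultimately show "triple_term b r t x (k, m, n - m)
        = ?C * (qpoch ?B q m * (qpoch r q (n - m) * ?B ^ (n - m))
            / (qpoch q q m * qpoch q q (n - m)))"
      using qpoch_nonzero[of b q k] assms(1)
      by (simp add: n triple_term_def choose_two_add power_add add.assoc mult_ac)
  qed simp
  also have "\<dots> = ?C * (qpoch (r * ?B) q n / qpoch q q n)"
    unfolding sum_distrib_left[symmetric] q_Vandermonde ..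
  also have "\<dots> = (x * t) ^ k / (qpoch q q k * qpoch (r * b) q k)
        * ((-1) ^ n * q ^ (n choose 2) / qpoch q q n * t ^ n)"
    using qpoch_nonzero[of "r * b" q "k + n"] assms(2)
    by (simp add: qpoch_add mult.assoc power_minus[of t])
  finally show ?thesis .
qed

lemma triple_term_row_has_sum:
  assumes "\<And>j. r * b * q ^ j \<noteq> 1"
  shows "((\<lambda>j. triple_term b r t x (k, m, j)) has_sum
      (x * t) ^ k / (qpoch b q k * qpoch q q k) * ((- t) ^ m * q ^ (m choose 2) / qpoch q q m)
        * (qpoch b q (k + m) / qpoch (r * b) q (k + m))
        * qhyp [r] [r * b * q ^ (k + m)] q (b * q ^ (k + m) * t)) UNIV"
proof -
  have "r * b * q ^ (k + m) * q ^ j \<noteq> 1" for j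
    using assms[of "k + m + j"] by (simp add: power_add mult_ac)
  from has_sum_cmult_right[OF qhyp_1_1_has_sum[OF this],
      of "(x * t) ^ k / (qpoch b q k * qpoch q q k) * ((- t) ^ m * q ^ (m choose 2) / qpoch q q m)
        * (qpoch b q (k + m) / qpoch (r * b) q (k + m))" r "b * q ^ (k + m) * t"]
  show ?thesis
    by (rule has_sum_cong[THEN iffD1, rotated])
       (simp add: triple_term_def qhyp_term_def qpoch_list_def qpoch_add[of "r * b" q "k + m"]
          power_minus[of "b * q ^ (k + m) * t"], simp add: mult_ac)
qed

section \<open>The generating function\<close>

text \<open>
  The sum \<open>S\<close> of the triple series is computed in two ways: over \<open>j\<close> first and then along
  \<open>k + m = n\<close>, and, for each \<open>k\<close>, along \<open>m + j = n\<close>.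
\<close>

theorem little_q_laguerre_generating_function:
  assumes q: "q \<noteq> 0"
    and b: "\<And>j. b * q * q ^ j \<noteq> 1"
    and rb: "\<And>j. r * (b * q) * q ^ j \<noteq> 1"
    and xt: "norm (x * t) < 1"
  shows "(\<lambda>n. q ^ (n choose 2) * (- t) ^ n * qpoch (b * q) q n
              / (qpoch q q n * qpoch (r * (b * q)) q n)
              * little_q_laguerre n x b q
              * qhyp [r] [r * (b * q) * q ^ n] q (b * q * q ^ n * t))
         sums (qpoch_inf t q / qpoch_inf (x * t) q
            * qhyp [] [r * (b * q)] q (r * (b * q) * (x * t)))"
proof -
  let ?T = "triple_term (b * q) r t x"
  define S where "S = infsum ?T UNIV"
  have T: "(?T has_sum S) UNIV"
    unfolding S_def by (rule has_sum_infsum[OF abs_summable_summable[OF abs_summable_triple_term[OF b rb xt]]])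
  let ?\<phi> = "\<lambda>n. qhyp [r] [r * (b * q) * q ^ n] q (b * q * q ^ n * t)"
  let ?row = "\<lambda>k m. (x * t) ^ k / (qpoch (b * q) q k * qpoch q q k)
        * ((- t) ^ m * q ^ (m choose 2) / qpoch q q m)
        * (qpoch (b * q) q (k + m) / qpoch (r * (b * q)) q (k + m)) * ?\<phi> (k + m)"
  have rows: "((\<lambda>n. \<Sum>k\<le>n. ?row k (n - k)) has_sum S) UNIV"
  proof -
    have "((\<lambda>((k, m), j). ?T (k, m, j)) has_sum S) (Sigma UNIV (\<lambda>_. UNIV)) \<longleftrightarrow> (?T has_sum S) UNIV"
      by (rule has_sum_reindex_bij_witness[of _ "\<lambda>(k, m, j). ((k, m), j)" "\<lambda>((k, m), j). (k, m, j)"])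
         auto
    with T have "((\<lambda>((k, m), j). ?T (k, m, j)) has_sum S) (Sigma UNIV (\<lambda>_. UNIV))"
      by simp
    moreover have "((\<lambda>j. (\<lambda>((k, m), j). ?T (k, m, j)) (p, j)) has_sum
        (\<lambda>(k, m). ?row k m) p) UNIV" for p
      by (cases p) (simp only: prod.case triple_term_row_has_sum[OF rb])
    ultimately have "((\<lambda>(k, m). ?row k m) has_sum S) UNIV"
      by (rule has_sum_SigmaD)
    from has_sum_antidiagonals[OF this] show ?thesis by simp
  qed
  have "(\<Sum>k\<le>n. ?row k (n - k))
      = q ^ (n choose 2) * (- t) ^ n * qpoch (b * q) q n
              / (qpoch q q n * qpoch (r * (b * q)) q n)
              * little_q_laguerre n x b q * ?\<phi> n" for n
  proof -
    let ?D = "(- t) ^ n * (qpoch (b * q) q n / qpoch (r * (b * q)) q n) * ?\<phi> n"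
    have "(\<Sum>k\<le>n. ?row k (n - k)) = (\<Sum>k\<le>n. ?D * ((- x) ^ k * q ^ ((n - k) choose 2)
            / (qpoch (b * q) q k * qpoch q q k * qpoch q q (n - k))))"
    proof (rule sum.cong)
      fix k assume "k \<in> {..n}"
      then have "(- t) ^ n = (- t) ^ k * (- t) ^ (n - k)" by (simp flip: power_add)
      then have "(x * t) ^ k * (- t) ^ (n - k) = (- t) ^ n * (- x) ^ k"
        by (simp flip: power_mult_distrib add: mult_ac)
      with \<open>k \<in> {..n}\<close> show "?row k (n - k) = ?D * ((- x) ^ k * q ^ ((n - k) choose 2)
            / (qpoch (b * q) q k * qpoch q q k * qpoch q q (n - k)))"
        by (simp add: divide_simps mult.assoc)
    qed simp
    also have "\<dots> = ?D * (q ^ (n choose 2) * little_q_laguerre n x b q / qpoch q q n)"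
      unfolding little_q_laguerre_expansion[OF q] sum_distrib_left ..
    finally show ?thesis by (simp add: mult_ac)
  qed
  with rows have "(\<lambda>n. q ^ (n choose 2) * (- t) ^ n * qpoch (b * q) q n
              / (qpoch q q n * qpoch (r * (b * q)) q n)
              * little_q_laguerre n x b q * ?\<phi> n) sums S"
    by (intro has_sum_imp_sums) simp
  moreover have "S = qpoch_inf t q / qpoch_inf (x * t) q
            * qhyp [] [r * (b * q)] q (r * (b * q) * (x * t))"
  proof -
    let ?a = "\<lambda>k. (x * t) ^ k / (qpoch q q k * qpoch (r * (b * q)) q k)"
    have "((\<lambda>p. ?T (k, p)) has_sum ?a k * qpoch_inf t q) UNIV" for k
    proof -
      have "(\<lambda>(k, p). ?T (k, p)) summable_on Sigma UNIV (\<lambda>_. UNIV)"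
        using T by (auto simp: summable_on_def)
      then have "(\<lambda>p. ?T (k, p)) summable_on UNIV"
        by (rule summable_on_SigmaD1) auto
      then obtain R where R: "((\<lambda>p. ?T (k, p)) has_sum R) UNIV"
        unfolding summable_on_def by blast
      from has_sum_imp_sums[OF has_sum_antidiagonals[OF this]]
      have "(\<lambda>n. ?a k * ((-1) ^ n * q ^ (n choose 2) / qpoch q q n * t ^ n)) sums R"
        by (simp add: sum_triple_term b rb)
      moreover have "(\<lambda>n. ?a k * ((-1) ^ n * q ^ (n choose 2) / qpoch q q n * t ^ n))
          sums (?a k * qpoch_inf t q)"
        by (rule sums_mult[OF Euler_qpoch_inf])
      ultimately have "R = ?a k * qpoch_inf t q" by (rule sums_unique2)
      with R show ?thesis by simp
    qed
    moreover have "(?T has_sum S) (Sigma UNIV (\<lambda>_. UNIV))"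
      using T by simp
    ultimately have "((\<lambda>k. ?a k * qpoch_inf t q) has_sum S) UNIV"
      by (intro has_sum_SigmaD[of ?T]) auto
    then have "(\<lambda>k. ?a k * qpoch_inf t q) sums S"
      by (rule has_sum_imp_sums)
    moreover have "(\<lambda>k. ?a k * qpoch_inf t q)
        sums (qhyp [] [r * (b * q)] q (r * (b * q) * (x * t)) / qpoch_inf (x * t) q * qpoch_inf t q)"
      by (intro sums_mult2 qhyp_0_1_sums rb xt)
    ultimately show ?thesis
      by (auto dest: sums_unique2)
  qed
  ultimately show ?thesis by simp
qed

end

text \<open>
  Since the interval that contains \<open>a\<close> is nonempty, \<open>q\<close> is positive, so \<open>a q\<close> and \<open>b q\<close> lie strictly between \<open>0\<close> and \<open>1\<close>
  and none of the lower parameters makes a denominator vanish. The general version applies with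
  \<open>r = a / b\<close>.
\<close>

theorem theorem11:
  fixes q a b :: real and t x :: complex
  assumes q: "0 < \<bar>q\<bar>" "\<bar>q\<bar> < 1"
    and a: "a \<in> {0<..<inverse q}"
    and b: "b \<in> {0<..<inverse q}"
    and t: "norm t < min ((1 - q) * (1 - a * q) / a) 1"
    and xt: "norm (x * t) < 1"
  shows "(\<lambda>n. of_real q ^ (n choose 2) * (- t) ^ n * qpoch (of_real (b * q)) (of_real q) n
              / (qpoch (of_real q) (of_real q) n * qpoch (of_real (a * q)) (of_real q) n)
              * little_q_laguerre n x (of_real b) (of_real q)
              * qhyp [of_real (a / b)] [of_real (a * q ^ (n + 1))] (of_real q)
                  (of_real (b * q ^ (n + 1)) * t))
         sums
         (qpoch_inf t (of_real q) / qpoch_inf (x * t) (of_real q)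
            * qhyp [] [of_real (a * q)] (of_real q) (of_real (a * q) * x * t))"
proof -
  have "0 < inverse q" using a by (meson greaterThanLessThan_iff less_trans)
  then have "0 < q" by simp
  have shifted_neq_1: "complex_of_real c * of_real q * of_real q ^ j \<noteq> 1"
    if "c \<in> {0<..<inverse q}" for c j
  proof -
    have "0 < c * q" "c * q < 1"
      using that \<open>0 < q\<close> by (auto simp: field_simps)
    then have "norm (complex_of_real (c * q)) < 1" by (simp only: norm_of_real abs_of_pos)
    moreover have "norm (complex_of_real q) < 1" using q by simp
    ultimately have "complex_of_real (c * q) * of_real q ^ j \<noteq> 1"
      by (rule mult_power_neq_1)
    then show ?thesis by simp
  qed
  have ab: "complex_of_real (a / b) * (of_real b * of_real q) = of_real a * of_real q"
    using b by simp
  have "norm (complex_of_real q) < 1" using q by simp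
  from little_q_laguerre_generating_function[OF this, of "of_real b" "of_real (a / b)" x t,
      unfolded ab, OF _ shifted_neq_1[OF b] shifted_neq_1[OF a] xt]
  have "(\<lambda>n. of_real q ^ (n choose 2) * (- t) ^ n * qpoch (of_real b * of_real q) (of_real q) n
          / (qpoch (of_real q) (of_real q) n * qpoch (of_real a * of_real q) (of_real q) n)
          * little_q_laguerre n x (of_real b) (of_real q)
          * qhyp [of_real (a / b)] [of_real a * of_real q * of_real q ^ n] (of_real q)
              (of_real b * of_real q * of_real q ^ n * t))
      sums (qpoch_inf t (of_real q) / qpoch_inf (x * t) (of_real q)
          * qhyp [] [of_real a * of_real q] (of_real q) (of_real a * of_real q * (x * t)))"
    using \<open>0 < q\<close> by simp
  moreover have "complex_of_real (c * q ^ (n + 1)) = of_real c * of_real q * of_real q ^ n" for c n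
    by simp
  ultimately show ?thesis
    by (simp only: of_real_mult mult.assoc)
qed

end
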